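(* Let $n_1,\dots,n_k,m_1,\dots,m_k\ge 2$ be integers such that for each $i$, $n_i$ and $m_i$ have the same number of distinct prime factors and the same exponents, i.e. $n_i=p_{i,1}^{\alpha_{i,1}}\cdots p_{i,j_i}^{\alpha_{i,j_i}}$ and $m_i=q_{i,1}^{\alpha_{i,1}}\cdots q_{i,j_i}^{\alpha_{i,j_i}}$ with the $p_{i,l}$ distinct primes and the $q_{i,l}$ distinct primes. Then the type graphs $\Gamma^T(\mathbb{Z}_{n_1}\times\cdots\times\mathbb{Z}_{n_k})$ and $\Gamma^T(\mathbb{Z}_{m_1}\times\cdots\times\mathbb{Z}_{m_k})$ are isomorphic.
   Context: For integers $n_1,\dots,n_k\ge2$, the type graph $\Gamma^T(\mathbb{Z}_{n_1}\times\cdots\times\mathbb{Z}_{n_k})$ is the simple graph defined as follows. Its vertices are the type classes $T(x_1,\dots,x_k)$, where each $x_i$ is either $0$ or a positive divisor of $n_i$ with $x_i<n_i$ (so $x_i=1$ is allowed), and $(x_1,\dots,x_k)$ is neither $(0,\dots,0)$ nor $(1,\dots,1)$. Here $T(x_1,\dots,x_k)$ is the set of tuples $(a_1,\dots,a_k)\in\mathbb{Z}_{n_1}\times\cdots\times\mathbb{Z}_{n_k}$ such that $a_i=0$ if $x_i=0$, and $a_i\neq0$ with $\gcd(a_i,n_i)=x_i$ if $x_i\neq 0$. Two distinct vertices $T(x_1,\dots,x_k)$ and $T(y_1,\dots,y_k)$ are adjacent iff $x_iy_i\equiv 0\pmod{n_i}$ for all $i$. *)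

theory Defs
  imports
    "HOL-Number_Theory.Residues"
    "HOL-Algebra.Chinese_Remainder"
    "Graph_Theory.Graph_Theory"
begin

text \<open>
  A list \<open>ns = [n\<^sub>1, \<dots>, n\<^sub>k]\<close> of moduli determines the ring
  \<open>\<int>\<^bsub>n\<^sub>1\<^esub> \<times> \<dots> \<times> \<int>\<^bsub>n\<^sub>k\<^esub>\<close>, whose elements are the lists of length \<open>k\<close> with
  \<open>i\<close>-th entry an integer in \<open>{0..n\<^sub>i - 1}\<close>.
\<close>

definition Z_prod :: "int list \<Rightarrow> int list ring" where
  "Z_prod ns = RDirProd_list (map residue_ring ns)"

definition T_class :: "int list \<Rightarrow> int list \<Rightarrow> int list set" where
  "T_class ns xs =
     {as \<in> carrier (Z_prod ns). \<forall>i < length ns.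
        (if xs ! i = 0 then as ! i = 0
         else as ! i \<noteq> 0 \<and> gcd (as ! i) (ns ! i) = xs ! i)}"

definition type_indices :: "int list \<Rightarrow> int list set" where
  "type_indices ns =
     {xs. length xs = length ns \<and>
          (\<forall>i < length ns. xs ! i = 0 \<or> (0 < xs ! i \<and> xs ! i dvd ns ! i \<and> xs ! i < ns ! i)) \<and>
          xs \<noteq> replicate (length ns) 0 \<and>
          xs \<noteq> replicate (length ns) 1}"

text \<open>
  The vertices are the type classes themselves, as sets of tuples.  An undirected edge is
  represented by its two orientations.
\<close>

definition type_graph :: "int list \<Rightarrow> int list set pair_pre_digraph" where
  "type_graph ns =
     \<lparr> pverts = T_class ns ` type_indices ns,
       parcs = {(T_class ns xs, T_class ns ys) | xs ys.
                  xs \<in> type_indices ns \<and> ys \<in> type_indices ns \<and>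
                  T_class ns xs \<noteq> T_class ns ys \<and>
                  (\<forall>i < length ns. [xs ! i * ys ! i = 0] (mod ns ! i))} \<rparr>"

lemma mem_carrier_Z_prod_iff:
  "as \<in> carrier (Z_prod ns) \<longleftrightarrow>
     length as = length ns \<and> (\<forall>i < length ns. 0 \<le> as ! i \<and> as ! i < ns ! i)"
  using RDirProd_list_carrier_mem[of as "map residue_ring ns"]
    RDirProd_list_carrier_memI[of as "map residue_ring ns"]
  by (auto simp: Z_prod_def residue_ring_def)

lemma finite_type_indices: "finite (type_indices ns)"
proof (rule finite_subset)
  let ?S = "\<Union>n \<in> set ns. insert 0 {0..<n}"
  show "type_indices ns \<subseteq> {xs. set xs \<subseteq> ?S \<and> length xs = length ns}"
  proof (safe)
    fix xs x assume xs: "xs \<in> type_indices ns" and "x \<in> set xs"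
    then obtain i where i: "i < length ns" "x = xs ! i"
      by (auto simp: type_indices_def in_set_conv_nth)
    then have "x \<in> insert 0 {0..<ns ! i}"
      using xs by (auto simp: type_indices_def)
    with i show "x \<in> ?S"
      by (meson UN_I nth_mem)
  qed (simp add: type_indices_def)
  show "finite {xs. set xs \<subseteq> ?S \<and> length xs = length ns}"
    by (rule finite_lists_length_eq) simp
qed

lemma T_class_inj: "inj_on (T_class ns) (type_indices ns)"
  if pos: "\<forall>i < length ns. 2 \<le> ns ! i"
proof (rule inj_onI)
  fix xs ys
  assume x: "xs \<in> type_indices ns" and y: "ys \<in> type_indices ns"
    and eq: "T_class ns xs = T_class ns ys"
  have lt: "0 \<le> xs ! i \<and> xs ! i < ns ! i" if "i < length ns" for i
    using x pos that by (force simp: type_indices_def)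
  have g: "gcd (xs ! i) (ns ! i) = xs ! i" if "i < length ns" "xs ! i \<noteq> 0" for i
  proof -
    have "0 < xs ! i" "xs ! i dvd ns ! i" using x that by (auto simp: type_indices_def)
    then show ?thesis by (simp add: gcd_proj1_iff)
  qed
  have l: "length xs = length ns" "length ys = length ns"
    using x y by (auto simp: type_indices_def)
  have "xs \<in> T_class ns xs"
    using l lt g by (auto simp: T_class_def mem_carrier_Z_prod_iff)
  with eq have xm: "xs \<in> T_class ns ys" by simp
  show "xs = ys"
  proof (rule nth_equalityI)
    fix i assume "i < length xs"
    then have i: "i < length ns" using l by simp
    then have *: "if ys ! i = 0 then xs ! i = 0 else xs ! i \<noteq> 0 \<and> gcd (xs ! i) (ns ! i) = ys ! i"
      using xm by (simp add: T_class_def)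
    show "xs ! i = ys ! i"
      using * g[OF i] by (auto split: if_splits)
  qed (simp add: l)
qed

lemma pair_graph_type_graph: "pair_graph (type_graph ns)"
proof
  show "finite (pverts (type_graph ns))"
    by (simp add: type_graph_def finite_type_indices)
  have "parcs (type_graph ns) \<subseteq> pverts (type_graph ns) \<times> pverts (type_graph ns)"
    by (auto simp: type_graph_def)
  then show "finite (parcs (type_graph ns))"
    by (rule finite_subset) (simp add: type_graph_def finite_type_indices)
  show "symmetric (with_proj (type_graph ns))"
    unfolding symmetric_def with_proj_simps
  proof (rule symI)
    fix U V assume "(U, V) \<in> parcs (type_graph ns)"
    then obtain xs ys where
      "U = T_class ns xs" "V = T_class ns ys" "xs \<in> type_indices ns" "ys \<in> type_indices ns"
      "T_class ns xs \<noteq> T_class ns ys" "\<forall>i < length ns. [xs ! i * ys ! i = 0] (mod ns ! i)"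
      unfolding type_graph_def by auto
    then have "V = T_class ns ys \<and> U = T_class ns xs \<and> ys \<in> type_indices ns \<and>
        xs \<in> type_indices ns \<and> T_class ns ys \<noteq> T_class ns xs \<and>
        (\<forall>i < length ns. [ys ! i * xs ! i = 0] (mod ns ! i))"
      by (metis mult.commute)
    then show "(V, U) \<in> parcs (type_graph ns)"
      unfolding type_graph_def by auto
  qed
qed (auto simp: type_graph_def)

end

theory Submission
  imports Defs
begin

text \<open>
  Since \<open>0\<close> and \<open>n\<close> generate the same ideal of \<open>\<int>\<^bsub>n\<^esub>\<close>, the admissible values of one coordinate
  correspond to the divisors of \<open>n\<close>, hence to exponent vectors bounded by that of \<open>n\<close>, and
  \<open>n dvd x * y\<close> only compares exponents.  Replacing the primes of each \<open>n\<^sub>i\<close> by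
  those of \<open>m\<^sub>i\<close> while keeping the exponents is therefore a bijection on the type indices
  that preserves adjacency.
\<close>

definition type_entries :: "int \<Rightarrow> int set" where
  "type_entries n = {x. x = 0 \<or> 0 < x \<and> x dvd n \<and> x < n}"

text \<open>Zero is split off because \<open>multiplicity (p l) 0\<close> is 0 by convention, so the
  product would send 0 to 1.\<close>

definition replace_primes :: "nat \<Rightarrow> (nat \<Rightarrow> int) \<Rightarrow> (nat \<Rightarrow> int) \<Rightarrow> int \<Rightarrow> int" where
  "replace_primes J p q x = (if x = 0 then 0 else \<Prod>l<J. q l ^ multiplicity (p l) x)"

section \<open>Multiplicities and divisibility for products of powers of distinct primes\<close>

context
  fixes J :: nat and p :: "nat \<Rightarrow> int"
  assumes prime_p: "\<And>l. l < J \<Longrightarrow> prime (p l)"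
    and inj_p: "inj_on p {..<J}"
begin

text \<open>The sum form treats primes inside and outside the family p at once; the next two lemmas
  specialise it.\<close>

lemma multiplicity_prod_powers:
  assumes "prime r"
  shows "multiplicity r (\<Prod>l<J. p l ^ e l) = (\<Sum>l<J. if p l = r then e l else 0)"
proof -
  have "multiplicity r (\<Prod>l<J. p l ^ e l) = (\<Sum>l<J. multiplicity r (p l ^ e l))"
    using assms prime_p by (intro prime_elem_multiplicity_prod_distrib) (auto, metis not_prime_0)
  also have "\<dots> = (\<Sum>l<J. if p l = r then e l else 0)"
    using assms prime_p
    by (intro sum.cong) (auto simp: multiplicity_distinct_prime_power)
  finally show ?thesis .
qed

lemma multiplicity_prod_powers_nth:
  assumes "l < J"
  shows "multiplicity (p l) (\<Prod>l<J. p l ^ e l) = e l"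
proof -
  \<comment> \<open>Distinctness of the primes leaves a single nonzero summand.\<close>
  have "(\<Sum>k<J. if p k = p l then e k else 0) = (\<Sum>k<J. if k = l then e k else 0)"
    using inj_p assms by (intro sum.cong) (auto dest: inj_onD)
  then show ?thesis
    using assms prime_p by (simp add: multiplicity_prod_powers)
qed

lemma multiplicity_prod_powers_other:
  assumes "prime r" "r \<notin> p ` {..<J}"
  shows "multiplicity r (\<Prod>l<J. p l ^ e l) = 0"
  using assms by (auto simp: multiplicity_prod_powers)

lemma prod_powers_pos: "0 < (\<Prod>l<J. p l ^ e l)"
  using prime_p by (auto intro!: prod_pos zero_less_power simp: prime_gt_0_int)

text \<open>Divisibility of nonzero integers can be tested prime by prime, and primes outside the
  family impose nothing because their multiplicity in the product is 0. For z = 0 the convention on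
  multiplicities would break the equivalence.\<close>

lemma prod_powers_dvd_iff:
  assumes "z \<noteq> 0"
  shows "(\<Prod>l<J. p l ^ a l) dvd z \<longleftrightarrow> (\<forall>l<J. a l \<le> multiplicity (p l) z)"
proof
  assume "(\<Prod>l<J. p l ^ a l) dvd z"
  then show "\<forall>l<J. a l \<le> multiplicity (p l) z"
    using dvd_imp_multiplicity_le[OF _ assms] by (metis multiplicity_prod_powers_nth)
next
  assume le: "\<forall>l<J. a l \<le> multiplicity (p l) z"
  show "(\<Prod>l<J. p l ^ a l) dvd z"
  proof (rule multiplicity_le_imp_dvd)
    show "(\<Prod>l<J. p l ^ a l) \<noteq> 0"
      using prod_powers_pos[of a] by (metis less_irrefl)
    fix r :: int assume "prime r"
    then show "multiplicity r (\<Prod>l<J. p l ^ a l) \<le> multiplicity r z"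
      using le by (cases "r \<in> p ` {..<J}")
        (auto simp: multiplicity_prod_powers_nth multiplicity_prod_powers_other)
  qed
qed

text \<open>A divisor of the product has no prime factor outside the family, so its multiplicities
  at the \<open>p l\<close> determine it up to sign, and positivity fixes the sign.\<close>

lemma prod_powers_multiplicity:
  assumes "0 < x" "x dvd (\<Prod>l<J. p l ^ a l)"
  shows "(\<Prod>l<J. p l ^ multiplicity (p l) x) = x"
proof (rule multiplicity_eq_int)
  fix r :: int assume r: "prime r"
  show "multiplicity r (\<Prod>l<J. p l ^ multiplicity (p l) x) = multiplicity r x"
  proof (cases "r \<in> p ` {..<J}")
    case True
    then show ?thesis by (auto simp: multiplicity_prod_powers_nth)
  next
    case False
    have "multiplicity r x \<le> multiplicity r (\<Prod>l<J. p l ^ a l)"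
      using assms(2) prod_powers_pos[of a] by (metis dvd_imp_multiplicity_le less_irrefl)
    with False r show ?thesis by (simp add: multiplicity_prod_powers_other)
  qed
qed (use assms prod_powers_pos in auto)

end

section \<open>Replacing primes in one coordinate\<close>

locale equal_exponents =
  fixes J :: nat and p q :: "nat \<Rightarrow> int" and a :: "nat \<Rightarrow> nat" and n m :: int
  assumes prime_p: "\<And>l. l < J \<Longrightarrow> prime (p l)" and inj_p: "inj_on p {..<J}"
    and prime_q: "\<And>l. l < J \<Longrightarrow> prime (q l)" and inj_q: "inj_on q {..<J}"
    and n_eq: "n = (\<Prod>l<J. p l ^ a l)" and m_eq: "m = (\<Prod>l<J. q l ^ a l)"
begin

text \<open>Makes every fact about \<open>replace_primes J p q\<close> available for its inverse
  \<open>replace_primes J q p\<close>.\<close>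

lemma equal_exponents_sym: "equal_exponents J q p a m n"
  by unfold_locales (fact prime_p prime_q inj_p inj_q n_eq m_eq)+

lemma n_pos: "0 < n"
  unfolding n_eq using prime_p inj_p by (rule prod_powers_pos)

lemma n_dvd_iff: "z \<noteq> 0 \<Longrightarrow> n dvd z \<longleftrightarrow> (\<forall>l<J. a l \<le> multiplicity (p l) z)"
  unfolding n_eq using prime_p inj_p by (rule prod_powers_dvd_iff)

lemma m_dvd_iff: "z \<noteq> 0 \<Longrightarrow> m dvd z \<longleftrightarrow> (\<forall>l<J. a l \<le> multiplicity (q l) z)"
  unfolding m_eq using prime_q inj_q by (rule prod_powers_dvd_iff)

lemma replace_primes_0: "replace_primes J p q 0 = 0"
  by (simp add: replace_primes_def)

lemma replace_primes_1: "replace_primes J p q 1 = 1"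
  by (simp add: replace_primes_def)

lemma replace_primes_pos: "x \<noteq> 0 \<Longrightarrow> 0 < replace_primes J p q x"
  using prod_powers_pos[OF prime_q inj_q] by (simp add: replace_primes_def)

lemma multiplicity_replace_primes:
  "x \<noteq> 0 \<Longrightarrow> l < J \<Longrightarrow> multiplicity (q l) (replace_primes J p q x) = multiplicity (p l) x"
  using multiplicity_prod_powers_nth[OF prime_q inj_q] by (simp add: replace_primes_def)

text \<open>This carries adjacency. Multiplicity at a prime is additive on products of nonzero
  factors, so both sides compare each \<open>a l\<close> with the same sum of exponents; if a factor
  is 0, both sides hold.\<close>

lemma dvd_replace_primes_mult_iff:
  "m dvd replace_primes J p q x * replace_primes J p q y \<longleftrightarrow> n dvd x * y"
proof (cases "x = 0 \<or> y = 0")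
  case False
  then have "replace_primes J p q x \<noteq> 0" "replace_primes J p q y \<noteq> 0"
    using replace_primes_pos[of x] replace_primes_pos[of y] by auto
  with False have "multiplicity (q l) (replace_primes J p q x * replace_primes J p q y) =
      multiplicity (p l) (x * y)" if "l < J" for l
    using prime_imp_prime_elem[OF prime_p[OF that]] prime_imp_prime_elem[OF prime_q[OF that]] that
    by (simp add: prime_elem_multiplicity_mult_distrib multiplicity_replace_primes)
  then show ?thesis
    using False \<open>replace_primes J p q x \<noteq> 0\<close> \<open>replace_primes J p q y \<noteq> 0\<close>
    by (simp add: n_dvd_iff m_dvd_iff)
qed (auto simp: replace_primes_0)

text \<open>Going back restores the powers of the \<open>p l\<close> in x, and a positive divisor of
  n consists of nothing else.\<close>

lemma replace_primes_inverse:
  assumes "x \<in> type_entries n"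
  shows "replace_primes J q p (replace_primes J p q x) = x"
proof (cases "x = 0")
  case False
  with assms have x: "0 < x" "x dvd (\<Prod>l<J. p l ^ a l)"
    by (auto simp: type_entries_def n_eq)
  have "replace_primes J q p (replace_primes J p q x) = (\<Prod>l<J. p l ^ multiplicity (p l) x)"
    using False replace_primes_pos[of x]
    by (subst replace_primes_def) (simp add: multiplicity_replace_primes)
  then show ?thesis
    using prod_powers_multiplicity[OF prime_p inj_p x] by simp
qed (simp add: replace_primes_def)

lemma replace_primes_in_type_entries:
  assumes "x \<in> type_entries n"
  shows "replace_primes J p q x \<in> type_entries m"
proof (cases "x = 0")
  case False
  define y where "y = replace_primes J p q x"
  have x: "0 < x" "x dvd n" "x < n"
    using assms False by (auto simp: type_entries_def)
  have y: "0 < y"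
    using False by (simp add: y_def replace_primes_pos)
  have m: "0 < m"
    by (rule equal_exponents.n_pos[OF equal_exponents_sym])
  have "multiplicity (p l) x \<le> a l" if "l < J" for l
  proof -
    have "multiplicity (p l) x \<le> multiplicity (p l) n"
      using x n_pos by (intro dvd_imp_multiplicity_le) auto
    then show ?thesis
      using multiplicity_prod_powers_nth[OF prime_p inj_p that] by (simp add: n_eq)
  qed
  then have "y dvd m"
    using False by (auto simp: y_def replace_primes_def m_eq intro!: prod_dvd_prod le_imp_power_dvd)
  moreover have "y \<noteq> m"
  proof
    assume "y = m"
    \<comment> \<open>\<open>replace_primes\<close> fixes 1, so pairing x with 1 in the divisibility
      criterion transfers \<open>m dvd y\<close> to \<open>n dvd x\<close>, which is impossible for
      0 < x < n.\<close>
    then have "n dvd x"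
      using dvd_replace_primes_mult_iff[of x 1] by (simp add: y_def replace_primes_1)
    then show False
      using x by (auto dest: zdvd_imp_le)
  qed
  ultimately show ?thesis
    using y m by (auto simp: type_entries_def y_def[symmetric] dest: zdvd_imp_le)
qed (simp add: replace_primes_0 type_entries_def)

lemma bij_betw_replace_primes:
  "bij_betw (replace_primes J p q) (type_entries n) (type_entries m)"
proof -
  interpret sym: equal_exponents J q p a m n
    by (rule equal_exponents_sym)
  show ?thesis
    by (rule bij_betw_byWitness[where f' = "replace_primes J q p"])
      (auto simp: replace_primes_inverse sym.replace_primes_inverse
        replace_primes_in_type_entries sym.replace_primes_in_type_entries)
qed

end

section \<open>From single entries to tuples of entries\<close>

lemma type_indices_iff:
  "xs \<in> type_indices ns \<longleftrightarrow>
     length xs = length ns \<and> (\<forall>i < length ns. xs ! i \<in> type_entries (ns ! i)) \<and>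
     (\<exists>i < length ns. xs ! i \<noteq> 0) \<and> (\<exists>i < length ns. xs ! i \<noteq> 1)"
  by (auto simp: type_indices_def type_entries_def list_eq_iff_nth_eq)

text \<open>Coordinatewise bijections give a bijection of all tuples of entries; since each fixes 0
  and 1, the two excluded constant tuples on one side correspond to those on the other.\<close>

lemma bij_betw_type_indices:
  assumes len: "length ms = length ns"
    and gt1: "\<And>i. i < length ns \<Longrightarrow> 1 < ns ! i"
    and bij: "\<And>i. i < length ns \<Longrightarrow> bij_betw (f i) (type_entries (ns ! i)) (type_entries (ms ! i))"
    and f0: "\<And>i. i < length ns \<Longrightarrow> f i 0 = 0"
    and f1: "\<And>i. i < length ns \<Longrightarrow> f i 1 = 1"
  shows "bij_betw (\<lambda>xs. map (\<lambda>i. f i (xs ! i)) [0..<length ns]) (type_indices ns) (type_indices ms)"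
proof -
  have in_ms: "f i x \<in> type_entries (ms ! i)" if "i < length ns" "x \<in> type_entries (ns ! i)" for i x
    using bij[OF that(1)] that(2) by (rule bij_betwE[rule_format])
  have inj: "f i x = f i y \<longleftrightarrow> x = y"
    if "i < length ns" "x \<in> type_entries (ns ! i)" "y \<in> type_entries (ns ! i)" for i x y
    using bij_betw_imp_inj_on[OF bij[OF that(1)]] that(2,3) by (rule inj_on_eq_iff)
  \<comment> \<open>A modulus above 1 makes 1 an entry, so injectivity applies to the pairs (x, 0)
    and (x, 1).\<close>
  have entry_01: "0 \<in> type_entries (ns ! i)" "1 \<in> type_entries (ns ! i)" if "i < length ns" for i
    using gt1[OF that] by (auto simp: type_entries_def)
  have f_eq_0: "f i x = 0 \<longleftrightarrow> x = 0" and f_eq_1: "f i x = 1 \<longleftrightarrow> x = 1"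
    if "i < length ns" "x \<in> type_entries (ns ! i)" for i x
    using inj[OF that entry_01(1)[OF that(1)]] inj[OF that entry_01(2)[OF that(1)]]
      f0[OF that(1)] f1[OF that(1)] by simp_all
  show ?thesis
  proof (rule bij_betwI')
    fix xs ys assume xs: "xs \<in> type_indices ns" and ys: "ys \<in> type_indices ns"
    have "f i (xs ! i) = f i (ys ! i) \<longleftrightarrow> xs ! i = ys ! i" if "i < length ns" for i
      using that xs ys by (simp add: type_indices_iff inj)
    moreover have "length xs = length ns" "length ys = length ns"
      using xs ys by (simp_all add: type_indices_iff)
    ultimately show "map (\<lambda>i. f i (xs ! i)) [0..<length ns] = map (\<lambda>i. f i (ys ! i)) [0..<length ns]
        \<longleftrightarrow> xs = ys"
      using list_eq_iff_nth_eq[of xs ys] by auto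
  next
    fix xs assume "xs \<in> type_indices ns"
    then show "map (\<lambda>i. f i (xs ! i)) [0..<length ns] \<in> type_indices ms"
      by (simp add: type_indices_iff len in_ms f_eq_0 f_eq_1 cong: conj_cong)
  next
    fix ys assume ys: "ys \<in> type_indices ms"
    have "\<exists>x \<in> type_entries (ns ! i). f i x = ys ! i" if "i < length ns" for i
    proof -
      have "ys ! i \<in> type_entries (ms ! i)"
        using ys that len by (simp add: type_indices_iff)
      then show ?thesis
        using bij_betw_imp_surj_on[OF bij[OF that]] by (metis imageE)
    qed
    \<comment> \<open>Preimages chosen coordinate by coordinate; they are 0 or 1 exactly where ys
      is, so the tuple they form is not an excluded one.\<close>
    then obtain g where g: "g i \<in> type_entries (ns ! i)" "f i (g i) = ys ! i"
      if "i < length ns" for i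
      by metis
    show "\<exists>xs \<in> type_indices ns. ys = map (\<lambda>i. f i (xs ! i)) [0..<length ns]"
    proof
      show "ys = map (\<lambda>i. f i (map g [0..<length ns] ! i)) [0..<length ns]"
        using ys len g(2) by (intro nth_equalityI) (simp_all add: type_indices_iff)
      have "g i = 0 \<longleftrightarrow> ys ! i = 0" "g i = 1 \<longleftrightarrow> ys ! i = 1" if "i < length ns" for i
        using f_eq_0[OF that g(1)[OF that]] f_eq_1[OF that g(1)[OF that]] g(2)[OF that] by simp_all
      then show "map g [0..<length ns] \<in> type_indices ns"
        using ys len g(1) by (simp add: type_indices_iff cong: conj_cong)
    qed
  qed
qed

section \<open>Isomorphisms of pair digraphs and of type graphs\<close>

lemma digraph_iso_with_projI:
  assumes G: "pair_wf_digraph G"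
    and bij: "bij_betw h (pverts G) (pverts H)"
    and arcs: "parcs H = map_prod h h ` parcs G"
  shows "digraph_iso (with_proj G) (with_proj H)"
proof -
  \<comment> \<open>An arc of a pair digraph is the pair of its ends, so h dictates the map on arcs,
    and tail and head stay the two projections.\<close>
  let ?f = "\<lparr>iso_verts = h, iso_arcs = map_prod h h, iso_head = snd, iso_tail = fst\<rparr>"
  interpret pair_wf_digraph G by (fact G)
  have inj: "inj_on h (pverts G)"
    using bij by (rule bij_betw_imp_inj_on)
  have "parcs G \<subseteq> pverts G \<times> pverts G"
    using in_arcsD1 in_arcsD2 by auto
  then have "inj_on (map_prod h h) (parcs G)"
    by (rule inj_on_subset[OF map_prod_inj_on[OF inj inj]])
  then have "pre_digraph.digraph_isomorphism (with_proj G) ?f"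
    using inj wf_digraph_axioms by (simp add: pre_digraph.digraph_isomorphism_def)
  moreover have "with_proj H = app_iso ?f (with_proj G)"
    using bij_betw_imp_surj_on[OF bij] arcs by (simp add: app_iso_def with_proj_def)
  ultimately show ?thesis
    unfolding digraph_iso_def by blast
qed

lemma map_prod_image_eq: "map_prod f g ` E = {(f x, g y) | x y. (x, y) \<in> E}"
  by force

text \<open>Moves the problem from type classes to their index tuples, which is possible because
  \<open>T_class\<close> is injective on \<open>type_indices\<close> for moduli at least 2.\<close>

lemma digraph_iso_type_graphI:
  assumes ns: "\<forall>i < length ns. 2 \<le> ns ! i" and ms: "\<forall>i < length ms. 2 \<le> ms ! i"
    and bij: "bij_betw F (type_indices ns) (type_indices ms)"
    and adj: "\<And>xs ys. xs \<in> type_indices ns \<Longrightarrow> ys \<in> type_indices ns \<Longrightarrow>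
      (\<forall>i < length ms. [F xs ! i * F ys ! i = 0] (mod ms ! i)) \<longleftrightarrow>
      (\<forall>i < length ns. [xs ! i * ys ! i = 0] (mod ns ! i))"
  shows "digraph_iso (with_proj (type_graph ns)) (with_proj (type_graph ms))"
proof (rule digraph_iso_with_projI)
  \<comment> \<open>The map on classes induced by F: read off the index of a class, apply F, and
    take the class of the result.\<close>
  define h where "h = T_class ms \<circ> F \<circ> inv_into (type_indices ns) (T_class ns)"
  have h: "h (T_class ns xs) = T_class ms (F xs)" if "xs \<in> type_indices ns" for xs
    using that by (simp add: h_def inv_into_f_f[OF T_class_inj[OF ns]])
  have bij_ns: "bij_betw (T_class ns) (type_indices ns) (pverts (type_graph ns))"
    and bij_ms: "bij_betw (T_class ms) (type_indices ms) (pverts (type_graph ms))"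
    using T_class_inj[OF ns] T_class_inj[OF ms] by (auto simp: bij_betw_def type_graph_def)
  show "bij_betw h (pverts (type_graph ns)) (pverts (type_graph ms))"
    unfolding h_def
    using bij_betw_inv_into[OF bij_ns] bij bij_ms by (blast intro: bij_betw_trans)
  \<comment> \<open>Injectivity of \<open>T_class\<close> turns distinctness of classes into
    distinctness of indices, so the arcs are the image of a relation on tuples alone.\<close>
  have arcs: "parcs (type_graph ks) = map_prod (T_class ks) (T_class ks) `
      {(xs, ys). xs \<in> type_indices ks \<and> ys \<in> type_indices ks \<and> xs \<noteq> ys \<and>
        (\<forall>i < length ks. [xs ! i * ys ! i = 0] (mod ks ! i))}"
    (is "_ = _ ` ?E ks")
    if "\<forall>i < length ks. 2 \<le> ks ! i" for ks
  proof -
    have "parcs (type_graph ks) = {(T_class ks xs, T_class ks ys) | xs ys. (xs, ys) \<in> ?E ks}"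
      using inj_on_eq_iff[OF T_class_inj[OF that]]
      by (simp add: type_graph_def cong: conj_cong)
    also have "\<dots> = map_prod (T_class ks) (T_class ks) ` ?E ks"
      by (rule map_prod_image_eq[symmetric])
    finally show ?thesis .
  qed
  have "?E ms = map_prod F F ` ?E ns"
  proof (intro equalityI subsetI)
    fix e assume "e \<in> ?E ms"
    then obtain us vs where e: "e = (us, vs)" "us \<in> type_indices ms" "vs \<in> type_indices ms"
      "us \<noteq> vs" "\<forall>i < length ms. [us ! i * vs ! i = 0] (mod ms ! i)"
      by blast
    obtain xs ys where "xs \<in> type_indices ns" "us = F xs" "ys \<in> type_indices ns" "vs = F ys"
      using bij_betw_imp_surj_on[OF bij] e(2,3) by blast
    then show "e \<in> map_prod F F ` ?E ns"
      using e adj[of xs ys] by (auto intro!: image_eqI[of _ _ "(xs, ys)"])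
  next
    fix e assume "e \<in> map_prod F F ` ?E ns"
    then obtain xs ys where "e = (F xs, F ys)" "xs \<in> type_indices ns" "ys \<in> type_indices ns"
      "xs \<noteq> ys" "\<forall>i < length ns. [xs ! i * ys ! i = 0] (mod ns ! i)"
      by auto
    then show "e \<in> ?E ms"
      using adj[of xs ys] bij_betwE[OF bij] inj_on_eq_iff[OF bij_betw_imp_inj_on[OF bij]] by auto
  qed
  \<comment> \<open>The square formed by F, h and the two maps \<open>T_class\<close> commutes on
    the type indices of ns.\<close>
  moreover have "map_prod (T_class ms) (T_class ms) ` map_prod F F ` ?E ns =
      map_prod h h ` map_prod (T_class ns) (T_class ns) ` ?E ns"
    unfolding image_image by (intro image_cong) (auto simp: h)
  ultimately show "parcs (type_graph ms) = map_prod h h ` parcs (type_graph ns)"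
    by (simp only: arcs[OF ns] arcs[OF ms])
  interpret pair_graph "type_graph ns" by (rule pair_graph_type_graph)
  show "pair_wf_digraph (type_graph ns)" ..
qed

theorem theorem1p10:
  fixes ns ms :: "int list"
    and j :: "nat \<Rightarrow> nat"
    and p q :: "nat \<Rightarrow> nat \<Rightarrow> int"
    and \<alpha> :: "nat \<Rightarrow> nat \<Rightarrow> nat"
  assumes "length ms = length ns"
    and "\<And>i. i < length ns \<Longrightarrow> ns ! i \<ge> 2"
    and "\<And>i. i < length ns \<Longrightarrow> ms ! i \<ge> 2"
    and "\<And>i l. i < length ns \<Longrightarrow> l < j i \<Longrightarrow> prime (p i l)"
    and "\<And>i l. i < length ns \<Longrightarrow> l < j i \<Longrightarrow> prime (q i l)"
    and "\<And>i. i < length ns \<Longrightarrow> inj_on (p i) {..<j i}"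
    and "\<And>i. i < length ns \<Longrightarrow> inj_on (q i) {..<j i}"
    and "\<And>i l. i < length ns \<Longrightarrow> l < j i \<Longrightarrow> \<alpha> i l \<ge> 1"
    and "\<And>i. i < length ns \<Longrightarrow> ns ! i = (\<Prod>l<j i. p i l ^ \<alpha> i l)"
    and "\<And>i. i < length ns \<Longrightarrow> ms ! i = (\<Prod>l<j i. q i l ^ \<alpha> i l)"
  shows "digraph_iso (with_proj (type_graph ns)) (with_proj (type_graph ms))"
proof -
  define f where "f i = replace_primes (j i) (p i) (q i)" for i
  have eq: "equal_exponents (j i) (p i) (q i) (\<alpha> i) (ns ! i) (ms ! i)" if "i < length ns" for i
    using assms that by unfold_locales auto
  show ?thesis
  proof (rule digraph_iso_type_graphI)
    show "bij_betw (\<lambda>xs. map (\<lambda>i. f i (xs ! i)) [0..<length ns]) (type_indices ns) (type_indices ms)"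
      using assms(1,2) eq
      by (intro bij_betw_type_indices)
        (force simp: f_def intro: equal_exponents.bij_betw_replace_primes
          equal_exponents.replace_primes_0 equal_exponents.replace_primes_1)+
  next
    fix xs ys assume "xs \<in> type_indices ns" "ys \<in> type_indices ns"
    show "(\<forall>i < length ms. [map (\<lambda>i. f i (xs ! i)) [0..<length ns] ! i *
          map (\<lambda>i. f i (ys ! i)) [0..<length ns] ! i = 0] (mod ms ! i)) \<longleftrightarrow>
        (\<forall>i < length ns. [xs ! i * ys ! i = 0] (mod ns ! i))"
      \<comment> \<open>Being congruent to 0 is divisibility by the modulus, so adjacency transfers
        coordinate by coordinate.\<close>
      using assms(1) equal_exponents.dvd_replace_primes_mult_iff[OF eq]
      by (simp add: f_def cong_0_iff)
  qed (use assms(1-3) in auto)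
qed

end
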